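(* Let $X$ be a finite set with $|X|=n$, for every $x\in X$ let $Y_x$ be a finite set, and let $Y:=\bigcup_{x\in X}Y_x$. Let probability transitions $(p^x\in\Delta(Y_x)\mid x\in X)$ from $X$ to $Y$ and $(p^y\in\Delta(X)\mid y\in Y)$ from $Y$ to $X$ be given, so that for every starting point $x_0\in X$ a time homogeneous Markov chain $x_0,y_1,x_2,y_3,\dots$ on $X\cup Y$ is defined, which is in $X$ at the even stages $i=0,2,4,\dots$ (position $x_i$) and in $Y$ at the odd stages (position $y_i$). Let $v:X\cup Y\to\mathbb R$ be harmonic with respect to these transitions (so that a martingale is formed), and let $M>0$ be a uniform bound for the maximal difference between values of $v$. Let $\delta>0$ be such that for every $x\in X$ and $y\in Y_x$ with $p^x(y)>0$ one has $|v(y)-v(x)|\le\delta$. If $0<\epsilon<1/2$ and $\delta\le \epsilon^3/(Mn)$, then the probability that there exists an (even) $l$ with $$\sum_{i=0,2,\dots}^{l}\bigl(v(y_{i+1})-v(x_i)\bigr)\ \ge\ \epsilon$$ does not exceed $\epsilon$.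
   Context: $\Delta(Z)$ is the set of probability distributions on the finite set $Z$. Harmonic means $v(x)=\sum_{y\in Y_x}p^x(y)v(y)$ for all $x\in X$ and $v(y)=\sum_{x\in X}p^y(x)v(x)$ for all $y\in Y$. *)

theory Defs
  imports "HOL-Probability.Probability"
begin

definition prob_dists :: "'a set \<Rightarrow> 'a pmf set" ("\<Delta>") where
  "\<Delta> Z = {p. set_pmf p \<subseteq> Z}"

definition harmonic ::
  "'a set \<Rightarrow> ('a \<Rightarrow> 'a set) \<Rightarrow> ('a \<Rightarrow> 'a pmf) \<Rightarrow> ('a \<Rightarrow> 'a pmf) \<Rightarrow> ('a \<Rightarrow> real) \<Rightarrow> bool" where
  "harmonic X Ys p q v \<longleftrightarrow>
     (\<forall>x\<in>X. v x = (\<Sum>y\<in>Ys x. pmf (p x) y * v y)) \<and>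
     (\<forall>y\<in>(\<Union>x\<in>X. Ys x). v y = (\<Sum>x\<in>X. pmf (q y) x * v x))"

text \<open>
  \<open>Z\<close> is the whole chain \<open>x\<^sub>0, y\<^sub>1, x\<^sub>2, y\<^sub>3, \<dots>\<close>, realised on an arbitrary probability space \<open>P\<close>.
  The sets \<open>X\<close> and \<open>Y\<close> are not required to be disjoint: the kernel used at stage \<open>k\<close> is selected by
  the parity of \<open>k\<close>. Measurability into \<open>count_space A\<close> includes that the values lie in \<open>A\<close>.
\<close>

definition alternating_markov_chain ::
  "'w measure \<Rightarrow> 'a set \<Rightarrow> 'a set \<Rightarrow> ('a \<Rightarrow> 'a pmf) \<Rightarrow> ('a \<Rightarrow> 'a pmf) \<Rightarrow> 'a
    \<Rightarrow> (nat \<Rightarrow> 'w \<Rightarrow> 'a) \<Rightarrow> bool" where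
  "alternating_markov_chain P X Y p q x0 Z \<longleftrightarrow>
     prob_space P \<and>
     (\<forall>k. Z k \<in> measurable P (count_space (if even k then X else Y))) \<and>
     (AE \<omega> in P. Z 0 \<omega> = x0) \<and>
     (\<forall>k a b. \<P>(\<omega> in P. \<forall>i\<le>k. Z i \<omega> = a i) > 0 \<longrightarrow>
        \<P>(\<omega> in P. Z (Suc k) \<omega> = b \<bar> \<forall>i\<le>k. Z i \<omega> = a i)
          = pmf (if even k then p (a k) else q (a k)) b)"

end

theory Submission
  imports Defs
begin

text \<open>
  Let \<open>S\<^sub>l\<close> be the sum of the increments \<open>v (y) - v (x)\<close> of the steps from \<open>X\<close> to \<open>Y\<close> up to
  time \<open>l\<close>. It is a martingale, so its second moment is the expected sum of the squares of these
  increments, which is at most \<open>\<delta>\<close> times their expected total absolute value \<open>V\<close>. The point is that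
  \<open>V\<close> stays bounded over the infinite time horizon: \<open>V \<le> M n\<close>. Fix \<open>x\<close> in \<open>X\<close>. Because \<open>v\<close> is
  harmonic, \<open>\<bar>v - v x\<bar>\<close> is a submartingale along the chain; whenever the chain leaves \<open>x\<close>, it starts
  from \<open>0\<close> and gains exactly the absolute increment. As it never exceeds \<open>M\<close>, the steps out of
  \<open>x\<close> contribute at most \<open>M\<close> to \<open>V\<close>, and there are \<open>n\<close> points \<open>x\<close>. Hence the second moments are at
  most \<open>\<delta> M n \<le> \<epsilon>\<^sup>3\<close>, and Kolmogorov's maximal inequality gives the probability bound
  \<open>\<epsilon>\<^sup>3 / \<epsilon>\<^sup>2 = \<epsilon>\<close>.

  Both halves of the argument fit into one supermartingale. Let \<open>T\<^sub>k\<close> be the sum stopped when it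
  reaches \<open>\<epsilon>\<close>; then \<open>T\<^sub>k\<^sup>2 - \<delta> (\<Sum>x\<in>X. \<bar>v Z\<^sub>k - v x\<bar>)\<close> decreases in the mean
  (\<open>potential_step\<close>) and starts at a value \<open>\<le> 0\<close>, so the second moment of \<open>T\<^sub>k\<close> is at most
  \<open>\<delta> n M\<close> (\<open>second_moment_stopped_sum\<close>). The sum reaches \<open>\<epsilon>\<close> before time \<open>k\<close> only if
  \<open>T\<^sub>k \<ge> \<epsilon>\<close>, to which Markov's inequality for \<open>T\<^sub>k\<^sup>2\<close> applies; the events grow with \<open>k\<close>, and
  continuity of the measure finishes the proof.
\<close>

section \<open>Chains on finite state sets\<close>

locale finite_chain = prob_space P for P :: "'w measure" +
  fixes S :: "nat \<Rightarrow> 'a set" and K :: "nat \<Rightarrow> 'a \<Rightarrow> 'a pmf" and Z :: "nat \<Rightarrow> 'w \<Rightarrow> 'a"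
  assumes finite_states: "finite (S k)"
    and measurable_state: "Z k \<in> measurable P (count_space (S k))"
    and transition: "\<P>(\<omega> in P. \<forall>i\<le>k. Z i \<omega> = a i) > 0 \<Longrightarrow>
        \<P>(\<omega> in P. Z (Suc k) \<omega> = b \<bar> \<forall>i\<le>k. Z i \<omega> = a i) = pmf (K k (a k)) b"
begin

definition trajectory :: "'w \<Rightarrow> nat \<Rightarrow> 'a" where
  "trajectory \<omega> = (\<lambda>i. Z i \<omega>)"

definition cylinder :: "nat \<Rightarrow> (nat \<Rightarrow> 'a) \<Rightarrow> 'w set" where
  "cylinder k h = {\<omega> \<in> space P. \<forall>i\<le>k. Z i \<omega> = h i}"

lemma state_in: "\<omega> \<in> space P \<Longrightarrow> Z k \<omega> \<in> S k"
  using measurable_space[OF measurable_state, of \<omega> k] by simp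

lemma sets_state: "{\<omega> \<in> space P. Z k \<omega> = a} \<in> sets P"
proof -
  have "Z k -` ({a} \<inter> S k) \<inter> space P \<in> sets P"
    by (rule measurable_sets[OF measurable_state]) auto
  also have "Z k -` ({a} \<inter> S k) \<inter> space P = {\<omega> \<in> space P. Z k \<omega> = a}"
    using state_in by auto
  finally show ?thesis .
qed

lemma sets_cylinder: "cylinder k h \<in> sets P"
proof -
  have "cylinder k h = (\<Inter>i\<in>{..k}. {\<omega> \<in> space P. Z i \<omega> = h i})"
    by (auto simp: cylinder_def)
  then show ?thesis
    using sets_state by (auto intro!: sets.finite_INT)
qed

text \<open>When the conditioning event is null the transition probability is unconstrained, but then
  both sides vanish.\<close>

lemma prob_cylinder_Suc:
  "prob (cylinder (Suc k) (h(Suc k := b))) = prob (cylinder k h) * pmf (K k (h k)) b"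
proof -
  let ?A = "{\<omega> \<in> space P. Z (Suc k) \<omega> = b \<and> (\<forall>i\<le>k. Z i \<omega> = h i)}"
  have A: "cylinder (Suc k) (h(Suc k := b)) = ?A"
    by (auto simp: cylinder_def le_Suc_eq)
  show ?thesis
  proof (cases "prob (cylinder k h) = 0")
    case True
    have "prob ?A \<le> prob (cylinder k h)"
      by (rule finite_measure_mono) (auto simp: sets_cylinder, auto simp: cylinder_def)
    then show ?thesis
      using True A measure_nonneg[of P ?A] by simp
  next
    case False
    then have pos: "prob (cylinder k h) > 0"
      by (simp add: zero_less_measure_iff)
    then have "prob ?A / prob (cylinder k h) = pmf (K k (h k)) b"
      using transition[of k h b] by (simp add: cond_prob_def cylinder_def)
    then show ?thesis
      using pos A by (simp add: field_simps)
  qed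
qed

text \<open>Functionals of the first \<open>k + 1\<close> positions take finitely many values, so their expectations
  are finite sums over the possible initial segments. This replaces conditional expectations.\<close>

lemma expectation_trajectory:
  fixes G :: "(nat \<Rightarrow> 'a) \<Rightarrow> real"
  assumes dep: "\<And>z w. (\<And>i. i \<le> k \<Longrightarrow> z i = w i) \<Longrightarrow> G z = G w"
  shows "integrable P (\<lambda>\<omega>. G (trajectory \<omega>))"
    and "expectation (\<lambda>\<omega>. G (trajectory \<omega>)) = (\<Sum>h\<in>PiE {..k} S. prob (cylinder k h) * G h)"
proof -
  let ?H = "PiE {..k} S"
  have fin: "finite ?H"
    using finite_states by (simp add: finite_PiE)
  have eq: "G (trajectory \<omega>) = (\<Sum>h\<in>?H. indicator (cylinder k h) \<omega> * G h)" if \<omega>: "\<omega> \<in> space P" for \<omega>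
  proof -
    let ?h = "restrict (trajectory \<omega>) {..k}"
    have h: "?h \<in> ?H"
      using state_in[OF \<omega>] by (auto simp: trajectory_def)
    have unique: "h = ?h" if "h \<in> ?H" "\<omega> \<in> cylinder k h" for h
      using that by (intro PiE_ext[of _ "{..k}" S _]) (auto simp: h cylinder_def trajectory_def)
    have "(\<Sum>h\<in>?H. indicator (cylinder k h) \<omega> * G h) = (\<Sum>h\<in>{?h}. indicator (cylinder k h) \<omega> * G h)"
      using fin h unique by (intro sum.mono_neutral_right) (auto simp: indicator_def)
    also have "\<dots> = G ?h"
      using \<omega> by (simp add: cylinder_def trajectory_def)
    also have "\<dots> = G (trajectory \<omega>)"
      by (rule dep) simp
    finally show ?thesis ..
  qed
  have int: "integrable P (\<lambda>\<omega>. \<Sum>h\<in>?H. indicator (cylinder k h) \<omega> * G h)"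
    using sets_cylinder by (intro Bochner_Integration.integrable_sum integrable_mult_left
        integrable_real_indicator) (auto simp: less_top[symmetric])
  then show "integrable P (\<lambda>\<omega>. G (trajectory \<omega>))"
    by (subst Bochner_Integration.integrable_cong[OF refl eq])
  have "expectation (\<lambda>\<omega>. G (trajectory \<omega>)) =
      expectation (\<lambda>\<omega>. \<Sum>h\<in>?H. indicator (cylinder k h) \<omega> * G h)"
    by (rule Bochner_Integration.integral_cong[OF refl eq])
  also have "\<dots> = (\<Sum>h\<in>?H. expectation (\<lambda>\<omega>. indicator (cylinder k h) \<omega> * G h))"
    using sets_cylinder by (intro Bochner_Integration.integral_sum integrable_mult_left
        integrable_real_indicator) (auto simp: less_top[symmetric])
  also have "\<dots> = (\<Sum>h\<in>?H. prob (cylinder k h) * G h)"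
    by (simp add: Int_absorb2[OF sets.sets_into_space[OF sets_cylinder]])
  finally show "expectation (\<lambda>\<omega>. G (trajectory \<omega>)) = \<dots>" .
qed

text \<open>The Markov property in integrated form: an inequality between a functional and the average of
  another one over the next position passes to expectations. This is all that is needed about the
  chain in order to handle supermartingales.\<close>

lemma expectation_step_le:
  fixes F G :: "(nat \<Rightarrow> 'a) \<Rightarrow> real"
  assumes depG: "\<And>z w. (\<And>i. i \<le> Suc k \<Longrightarrow> z i = w i) \<Longrightarrow> G z = G w"
    and depF: "\<And>z w. (\<And>i. i \<le> k \<Longrightarrow> z i = w i) \<Longrightarrow> F z = F w"
    and step: "\<And>h. h k \<in> S k \<Longrightarrow>
      (\<Sum>b\<in>S (Suc k). pmf (K k (h k)) b * G (h(Suc k := b))) \<le> F h"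
  shows "expectation (\<lambda>\<omega>. G (trajectory \<omega>)) \<le> expectation (\<lambda>\<omega>. F (trajectory \<omega>))"
proof -
  let ?H = "PiE {..k} S" and ?ext = "\<lambda>(b, h). h(Suc k := b)"
  have inj: "inj_on ?ext (S (Suc k) \<times> ?H)"
    by (rule inj_combinator) simp
  have H: "PiE {..Suc k} S = ?ext ` (S (Suc k) \<times> ?H)"
    by (simp add: atMost_Suc PiE_insert_eq)
  have "expectation (\<lambda>\<omega>. G (trajectory \<omega>)) = (\<Sum>h\<in>PiE {..Suc k} S. prob (cylinder (Suc k) h) * G h)"
    by (rule expectation_trajectory(2)[OF depG])
  also have "\<dots> = (\<Sum>b\<in>S (Suc k). \<Sum>h\<in>?H.
      prob (cylinder (Suc k) (h(Suc k := b))) * G (h(Suc k := b)))"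
    unfolding H sum.reindex[OF inj] sum.cartesian_product by (intro sum.cong) auto
  also have "\<dots> = (\<Sum>h\<in>?H. \<Sum>b\<in>S (Suc k).
      prob (cylinder (Suc k) (h(Suc k := b))) * G (h(Suc k := b)))"
    by (rule sum.swap)
  also have "\<dots> = (\<Sum>h\<in>?H. prob (cylinder k h) *
      (\<Sum>b\<in>S (Suc k). pmf (K k (h k)) b * G (h(Suc k := b))))"
    by (simp add: prob_cylinder_Suc sum_distrib_left mult.assoc)
  also have "\<dots> \<le> (\<Sum>h\<in>?H. prob (cylinder k h) * F h)"
    by (intro sum_mono mult_left_mono step) auto
  also have "\<dots> = expectation (\<lambda>\<omega>. F (trajectory \<omega>))"
    by (rule expectation_trajectory(2)[OF depF, symmetric])
  finally show ?thesis .
qed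

end

section \<open>The potential and its one-step decrease\<close>

text \<open>Each \<open>\<bar>v - v x\<bar>\<close> is a submartingale along the chain by the triangle inequality. When the chain leaves a point \<open>a\<close> of \<open>X\<close>, the term for \<open>a\<close> vanishes before the step,
  so it grows by the mean absolute increment \<open>D\<close>. Increments bounded by \<open>\<delta>\<close> have variance
  at most \<open>\<delta> D\<close>, and this growth pays for it.\<close>

lemma potential_step:
  fixes v :: "'a \<Rightarrow> real" and r :: "'a pmf" and \<delta> s t :: real
  assumes fin: "finite B" "finite X" and supp: "set_pmf r \<subseteq> B"
    and mean: "(\<Sum>b\<in>B. pmf r b * v b) = v a"
    and "\<delta> > 0"
    and small: "s \<noteq> 0 \<Longrightarrow> s = 1 \<and> a \<in> X \<and> (\<forall>b\<in>set_pmf r. \<bar>v b - v a\<bar> \<le> \<delta>)"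
  shows "(\<Sum>b\<in>B. pmf r b * ((t + s * (v b - v a))\<^sup>2 - \<delta> * (\<Sum>x\<in>X. \<bar>v b - v x\<bar>)))
    \<le> t\<^sup>2 - \<delta> * (\<Sum>x\<in>X. \<bar>v a - v x\<bar>)"
proof -
  define D where "D = (\<Sum>b\<in>B. pmf r b * \<bar>v b - v a\<bar>)"
  have one: "(\<Sum>b\<in>B. pmf r b) = 1"
    using fin supp by (intro sum_pmf_eq_1)
  have zero: "(\<Sum>b\<in>B. pmf r b * (v b - v a)) = 0"
    using mean by (simp add: right_diff_distrib sum_subtractf one flip: sum_distrib_right)
  have "(\<Sum>b\<in>B. pmf r b * (t + s * (v b - v a))\<^sup>2) =
      (\<Sum>b\<in>B. pmf r b * t\<^sup>2 + 2 * t * s * (pmf r b * (v b - v a)) + s\<^sup>2 * (pmf r b * (v b - v a)\<^sup>2))"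
    by (intro sum.cong) (auto simp: power2_eq_square algebra_simps)
  also have "\<dots> = t\<^sup>2 + s\<^sup>2 * (\<Sum>b\<in>B. pmf r b * (v b - v a)\<^sup>2)"
    by (simp add: sum.distrib one zero flip: sum_distrib_left sum_distrib_right)
  finally have square: "(\<Sum>b\<in>B. pmf r b * (t + s * (v b - v a))\<^sup>2) =
      t\<^sup>2 + s\<^sup>2 * (\<Sum>b\<in>B. pmf r b * (v b - v a)\<^sup>2)" .
  have jensen: "\<bar>v a - v x\<bar> \<le> (\<Sum>b\<in>B. pmf r b * \<bar>v b - v x\<bar>)" for x
  proof -
    have "v a - v x = (\<Sum>b\<in>B. pmf r b * (v b - v x))"
      using mean by (simp add: right_diff_distrib sum_subtractf one flip: sum_distrib_right)
    then have "\<bar>v a - v x\<bar> \<le> (\<Sum>b\<in>B. \<bar>pmf r b * (v b - v x)\<bar>)"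
      using sum_abs by metis
    then show ?thesis
      by (simp add: abs_mult)
  qed
  have swap: "(\<Sum>b\<in>B. pmf r b * (\<delta> * (\<Sum>x\<in>X. \<bar>v b - v x\<bar>))) =
      \<delta> * (\<Sum>x\<in>X. \<Sum>b\<in>B. pmf r b * \<bar>v b - v x\<bar>)"
    by (subst sum.swap) (simp add: sum_distrib_left mult.left_commute)
  have "s\<^sup>2 * (\<Sum>b\<in>B. pmf r b * (v b - v a)\<^sup>2) + \<delta> * (\<Sum>x\<in>X. \<bar>v a - v x\<bar>)
      \<le> \<delta> * (\<Sum>x\<in>X. \<Sum>b\<in>B. pmf r b * \<bar>v b - v x\<bar>)"
  proof (cases "s = 0")
    case True
    then show ?thesis
      using \<open>\<delta> > 0\<close> by (simp add: sum_mono jensen)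
  next
    case False
    then have s: "s = 1" and a: "a \<in> X" and le: "\<And>b. b \<in> set_pmf r \<Longrightarrow> \<bar>v b - v a\<bar> \<le> \<delta>"
      using small by auto
    have "pmf r b * (v b - v a)\<^sup>2 \<le> \<delta> * (pmf r b * \<bar>v b - v a\<bar>)" for b
    proof (cases "b \<in> set_pmf r")
      case True
      have "(v b - v a)\<^sup>2 = \<bar>v b - v a\<bar> * \<bar>v b - v a\<bar>"
        by (simp add: power2_eq_square)
      also have "\<dots> \<le> \<delta> * \<bar>v b - v a\<bar>"
        using le[OF True] by (intro mult_right_mono) auto
      finally have "pmf r b * (v b - v a)\<^sup>2 \<le> pmf r b * (\<delta> * \<bar>v b - v a\<bar>)"
        by (intro mult_left_mono) auto
      then show ?thesis
        by (simp add: mult.left_commute)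
    qed (simp add: set_pmf_iff)
    then have var: "(\<Sum>b\<in>B. pmf r b * (v b - v a)\<^sup>2) \<le> \<delta> * D"
      unfolding D_def sum_distrib_left by (intro sum_mono)
    have "D + (\<Sum>x\<in>X. \<bar>v a - v x\<bar>) = D + (\<Sum>x\<in>X - {a}. \<bar>v a - v x\<bar>)"
      using fin a by (simp add: sum.remove)
    also have "\<dots> \<le> D + (\<Sum>x\<in>X - {a}. \<Sum>b\<in>B. pmf r b * \<bar>v b - v x\<bar>)"
      by (intro add_left_mono sum_mono jensen)
    also have "\<dots> = (\<Sum>x\<in>X. \<Sum>b\<in>B. pmf r b * \<bar>v b - v x\<bar>)"
      using fin a by (simp add: sum.remove D_def)
    finally have "\<delta> * D + \<delta> * (\<Sum>x\<in>X. \<bar>v a - v x\<bar>)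
        \<le> \<delta> * (\<Sum>x\<in>X. \<Sum>b\<in>B. pmf r b * \<bar>v b - v x\<bar>)"
      using \<open>\<delta> > 0\<close> by (simp flip: distrib_left)
    then show ?thesis
      using var s by simp
  qed
  moreover have "(\<Sum>b\<in>B. pmf r b * ((t + s * (v b - v a))\<^sup>2 - \<delta> * (\<Sum>x\<in>X. \<bar>v b - v x\<bar>))) =
      (\<Sum>b\<in>B. pmf r b * (t + s * (v b - v a))\<^sup>2) -
      (\<Sum>b\<in>B. pmf r b * (\<delta> * (\<Sum>x\<in>X. \<bar>v b - v x\<bar>)))"
    by (simp only: right_diff_distrib[of "pmf r x" for x] sum_subtractf)
  ultimately show ?thesis
    unfolding square swap by linarith
qed

section \<open>Sums of even increments, stopped at the level\<close>

primrec stopped_sum :: "('a \<Rightarrow> real) \<Rightarrow> real \<Rightarrow> (nat \<Rightarrow> 'a) \<Rightarrow> nat \<Rightarrow> real" where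
  "stopped_sum v c z 0 = 0"
| "stopped_sum v c z (Suc k) = stopped_sum v c z k +
     of_bool (even k \<and> stopped_sum v c z k < c) * (v (z (Suc k)) - v (z k))"

lemma stopped_sum_cong:
  "(\<And>i. i \<le> k \<Longrightarrow> z i = w i) \<Longrightarrow> stopped_sum v c z k = stopped_sum v c w k"
  by (induction k) auto

lemma stopped_sum_stays:
  "stopped_sum v c z k \<ge> c \<Longrightarrow> k \<le> m \<Longrightarrow> stopped_sum v c z m \<ge> c"
  by (rotate_tac, induction m rule: dec_induct) auto

text \<open>Stopping hides no crossing: as long as the level has not been reached, the stopped sum is the
  full sum.\<close>

lemma stopped_sum_reaches:
  assumes "(\<Sum>i | i < k \<and> even i. v (z (i + 1)) - v (z i)) \<ge> c"
  shows "stopped_sum v c z k \<ge> c"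
proof -
  have "stopped_sum v c z k \<ge> c \<or>
      stopped_sum v c z k = (\<Sum>i | i < k \<and> even i. v (z (i + 1)) - v (z i))"
  proof (induction k)
    case (Suc k)
    let ?f = "\<lambda>i. v (z (i + 1)) - v (z i)"
    have "{i. i < Suc k \<and> even i} = (if even k then insert k {i. i < k \<and> even i} else {i. i < k \<and> even i})"
      by (auto simp: less_Suc_eq)
    then have Suc_sum: "(\<Sum>i | i < Suc k \<and> even i. ?f i) = (\<Sum>i | i < k \<and> even i. ?f i) + of_bool (even k) * ?f k"
      by simp
    show ?case
    proof (cases "stopped_sum v c z k \<ge> c")
      case True
      then show ?thesis
        by simp
    next
      case False
      then have "stopped_sum v c z k = (\<Sum>i | i < k \<and> even i. ?f i)"
        using Suc.IH by blast
      then show ?thesis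
        using False unfolding Suc_sum by simp
    qed
  qed simp
  then show ?thesis
    using assms by auto
qed

context finite_chain
begin

text \<open>The potential starts at a value \<open>\<le> 0\<close>, so at every time the mean square of the stopped sum is
  at most the mean of the subtracted term, which the oscillation of \<open>v\<close> bounds uniformly in time.\<close>

lemma second_moment_stopped_sum:
  fixes v :: "'a \<Rightarrow> real" and \<delta> c M :: real and X :: "'a set"
  assumes X: "finite X" and "\<delta> > 0"
    and even_states: "\<And>k. even k \<Longrightarrow> S k = X"
    and supp: "\<And>k a. a \<in> S k \<Longrightarrow> set_pmf (K k a) \<subseteq> S (Suc k)"
    and mean: "\<And>k a. a \<in> S k \<Longrightarrow> (\<Sum>b\<in>S (Suc k). pmf (K k a) b * v b) = v a"
    and small: "\<And>k a b. even k \<Longrightarrow> a \<in> X \<Longrightarrow> b \<in> set_pmf (K k a) \<Longrightarrow> \<bar>v b - v a\<bar> \<le> \<delta>"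
    and bound: "\<And>k a b. a \<in> S k \<Longrightarrow> b \<in> X \<Longrightarrow> \<bar>v a - v b\<bar> \<le> M"
  shows "integrable P (\<lambda>\<omega>. (stopped_sum v c (trajectory \<omega>) k)\<^sup>2)"
    and "expectation (\<lambda>\<omega>. (stopped_sum v c (trajectory \<omega>) k)\<^sup>2) \<le> \<delta> * (real (card X) * M)"
proof -
  let ?T = "\<lambda>k z. stopped_sum v c z k" and ?W = "\<lambda>k z. \<delta> * (\<Sum>x\<in>X. \<bar>v (z k) - v x\<bar>)"
  define \<Phi> where "\<Phi> k z = (?T k z)\<^sup>2 - ?W k z" for k z
  have dep: "\<Phi> k z = \<Phi> k w" if "\<And>i. i \<le> k \<Longrightarrow> z i = w i" for k z w
    using that stopped_sum_cong[of k z w] by (simp add: \<Phi>_def)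
  have "expectation (\<lambda>\<omega>. \<Phi> k (trajectory \<omega>)) \<le> 0" for k
  proof (induction k)
    case 0
    have "?W 0 z \<ge> 0" for z :: "nat \<Rightarrow> 'a"
      using \<open>\<delta> > 0\<close> by (intro mult_nonneg_nonneg sum_nonneg) auto
    then have "0 \<le> expectation (\<lambda>\<omega>. - \<Phi> 0 (trajectory \<omega>))"
      by (intro Bochner_Integration.integral_nonneg) (simp add: \<Phi>_def)
    then show ?case
      by simp
  next
    case (Suc k)
    have "expectation (\<lambda>\<omega>. \<Phi> (Suc k) (trajectory \<omega>)) \<le> expectation (\<lambda>\<omega>. \<Phi> k (trajectory \<omega>))"
    proof (rule expectation_step_le)
      fix h :: "nat \<Rightarrow> 'a"
      assume a: "h k \<in> S k"
      have T: "?T k (h(Suc k := b)) = ?T k h" for b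
        by (rule stopped_sum_cong) simp
      define s :: real where "s = of_bool (even k \<and> ?T k h < c)"
      have \<Phi>_Suc: "\<Phi> (Suc k) (h(Suc k := b)) =
          (?T k h + s * (v b - v (h k)))\<^sup>2 - \<delta> * (\<Sum>x\<in>X. \<bar>v b - v x\<bar>)" for b
        by (simp add: \<Phi>_def T s_def)
      show "(\<Sum>b\<in>S (Suc k). pmf (K k (h k)) b * \<Phi> (Suc k) (h(Suc k := b))) \<le> \<Phi> k h"
        unfolding \<Phi>_Suc unfolding \<Phi>_def
      proof (rule potential_step[OF finite_states X supp[OF a] mean[OF a] \<open>\<delta> > 0\<close>])
        assume "s \<noteq> 0"
        then have "s = 1" "even k"
          by (auto simp: s_def split: if_splits)
        then show "s = 1 \<and> h k \<in> X \<and> (\<forall>b\<in>set_pmf (K k (h k)). \<bar>v b - v (h k)\<bar> \<le> \<delta>)"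
          using a even_states small by auto
      qed
    qed (auto intro: dep)
    then show ?case
      using Suc.IH by linarith
  qed
  moreover have int_\<Phi>: "integrable P (\<lambda>\<omega>. \<Phi> k (trajectory \<omega>))"
    by (rule expectation_trajectory(1)) (rule dep)
  moreover have int_T: "integrable P (\<lambda>\<omega>. (?T k (trajectory \<omega>))\<^sup>2)"
    by (rule expectation_trajectory(1)[of k]) (metis stopped_sum_cong)
  moreover have int_W: "integrable P (\<lambda>\<omega>. ?W k (trajectory \<omega>))"
    by (rule expectation_trajectory(1)[of k]) simp
  ultimately have "expectation (\<lambda>\<omega>. (?T k (trajectory \<omega>))\<^sup>2) \<le> expectation (\<lambda>\<omega>. ?W k (trajectory \<omega>))"
    unfolding \<Phi>_def using Bochner_Integration.integral_diff[OF int_T int_W]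
    by (metis (no_types, lifting) diff_le_0_iff_le)
  also have "\<dots> \<le> expectation (\<lambda>\<omega>. \<delta> * (real (card X) * M))"
  proof (rule integral_mono[OF int_W])
    fix \<omega> assume "\<omega> \<in> space P"
    then have "(\<Sum>x\<in>X. \<bar>v (trajectory \<omega> k) - v x\<bar>) \<le> real (card X) * M"
      by (intro sum_bounded_above) (auto simp: trajectory_def intro: bound state_in)
    then show "?W k (trajectory \<omega>) \<le> \<delta> * (real (card X) * M)"
      using \<open>\<delta> > 0\<close> by simp
  qed simp
  finally show "expectation (\<lambda>\<omega>. (?T k (trajectory \<omega>))\<^sup>2) \<le> \<delta> * (real (card X) * M)"
    by (simp add: prob_space)
  show "integrable P (\<lambda>\<omega>. (?T k (trajectory \<omega>))\<^sup>2)"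
    by (rule int_T)
qed

end

lemma alternating_markov_chain_finite_chain:
  assumes "alternating_markov_chain P X Y p q x0 Z" "finite X" "finite Y"
  shows "finite_chain P (\<lambda>k. if even k then X else Y) (\<lambda>k. if even k then p else q) Z"
proof -
  have "prob_space P"
    using assms by (simp add: alternating_markov_chain_def)
  then interpret prob_space P .
  show ?thesis
    by standard (use assms in \<open>auto simp: alternating_markov_chain_def\<close>)
qed

theorem proposition4p2:
  fixes X Y :: "'a set" and Ys :: "'a \<Rightarrow> 'a set" and n :: nat
    and p q :: "'a \<Rightarrow> 'a pmf" and v :: "'a \<Rightarrow> real" and M \<delta> \<epsilon> :: real
    and P :: "'w measure" and x0 :: 'a and Z :: "nat \<Rightarrow> 'w \<Rightarrow> 'a"
  assumes "finite X" and "card X = n"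
    and "\<And>x. x \<in> X \<Longrightarrow> finite (Ys x)"
    and "Y = (\<Union>x\<in>X. Ys x)"
    and "\<And>x. x \<in> X \<Longrightarrow> p x \<in> \<Delta> (Ys x)"
    and "\<And>y. y \<in> Y \<Longrightarrow> q y \<in> \<Delta> X"
    and "x0 \<in> X"
    and "alternating_markov_chain P X Y p q x0 Z"
    and "harmonic X Ys p q v"
    and "M > 0" and "\<And>a b. a \<in> X \<union> Y \<Longrightarrow> b \<in> X \<union> Y \<Longrightarrow> \<bar>v a - v b\<bar> \<le> M"
    and "\<delta> > 0"
    and "\<And>x y. x \<in> X \<Longrightarrow> y \<in> Ys x \<Longrightarrow> pmf (p x) y > 0 \<Longrightarrow> \<bar>v y - v x\<bar> \<le> \<delta>"
    and "0 < \<epsilon>" and "\<epsilon> < 1 / 2"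
    and "\<delta> \<le> \<epsilon> ^ 3 / (M * real n)"
  shows "\<P>(\<omega> in P. \<exists>l. even l \<and>
           (\<Sum>i | i \<le> l \<and> even i. v (Z (i + 1) \<omega>) - v (Z i \<omega>)) \<ge> \<epsilon>) \<le> \<epsilon>"
proof -
  let ?S = "\<lambda>k. if even k then X else Y" and ?K = "\<lambda>k. if even k then p else q"
  have finY: "finite Y"
    using assms(1,3,4) by auto
  interpret finite_chain P ?S ?K Z
    using alternating_markov_chain_finite_chain[OF assms(8,1) finY] .
  have p_supp: "set_pmf (p x) \<subseteq> Ys x" and Ys: "Ys x \<subseteq> Y" if "x \<in> X" for x
    using that assms(4,5) by (auto simp: prob_dists_def)
  have p_supp_Y: "set_pmf (p x) \<subseteq> Y" if "x \<in> X" for x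
    using p_supp[OF that] Ys[OF that] by (rule subset_trans)
  have p_small: "\<bar>v b - v a\<bar> \<le> \<delta>" if "a \<in> X" "b \<in> set_pmf (p a)" for a b
    using assms(13)[of a b] p_supp that by (auto simp: pmf_positive)
  have q_supp: "set_pmf (q y) \<subseteq> X" if "y \<in> Y" for y
    using that assms(6) by (auto simp: prob_dists_def)
  have p_mean: "(\<Sum>b\<in>Y. pmf (p a) b * v b) = v a" if "a \<in> X" for a
  proof -
    have "(\<Sum>b\<in>Y. pmf (p a) b * v b) = (\<Sum>b\<in>Ys a. pmf (p a) b * v b)"
      using finY Ys[OF that] p_supp[OF that] by (intro sum.mono_neutral_right) (auto simp: set_pmf_iff)
    then show ?thesis
      using assms(9) that by (simp add: harmonic_def)
  qed
  have q_mean: "(\<Sum>b\<in>X. pmf (q a) b * v b) = v a" if "a \<in> Y" for a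
    using assms(4,9) that unfolding harmonic_def by metis
  let ?T = "\<lambda>k \<omega>. stopped_sum v \<epsilon> (trajectory \<omega>) k"
  have int: "integrable P (\<lambda>\<omega>. (?T k \<omega>)\<^sup>2)"
    and moment: "expectation (\<lambda>\<omega>. (?T k \<omega>)\<^sup>2) \<le> \<delta> * (real (card X) * M)" for k
  proof (atomize (full), intro conjI second_moment_stopped_sum)
  qed (use assms(1,11,12) p_mean q_mean p_supp_Y[THEN subsetD] q_supp[THEN subsetD] p_small in
      \<open>auto split: if_splits\<close>)
  have "n > 0"
    using assms(1,2,7) by (auto simp: card_gt_0_iff)
  then have "\<delta> * (real (card X) * M) \<le> \<epsilon> ^ 3"
    using assms(2,10,16) by (simp add: field_simps)
  then have moment': "expectation (\<lambda>\<omega>. (?T k \<omega>)\<^sup>2) \<le> \<epsilon> ^ 3" for k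
    using moment[of k] by linarith
  let ?A = "\<lambda>k. {\<omega> \<in> space P. ?T k \<omega> \<ge> \<epsilon>}"
  have T_int: "integrable P (?T k)" for k
    by (rule expectation_trajectory(1)[of k]) (rule stopped_sum_cong)
  have A_sets: "?A k \<in> sets P" for k
    using borel_measurable_integrable[OF T_int[of k]] by measurable
  have A_prob: "prob (?A k) \<le> \<epsilon>" for k
  proof -
    have "prob (?A k) \<le> prob {\<omega> \<in> space P. (?T k \<omega>)\<^sup>2 \<ge> \<epsilon>\<^sup>2}"
      using borel_measurable_integrable[OF int[of k]] assms(14)
      by (intro finite_measure_mono) (auto intro: power_mono)
    also have "\<dots> \<le> expectation (\<lambda>\<omega>. (?T k \<omega>)\<^sup>2) / \<epsilon>\<^sup>2"
      using assms(14) int by (intro integral_Markov_inequality_measure[where A = "space P"]) auto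
    also have "\<dots> \<le> \<epsilon> ^ 3 / \<epsilon>\<^sup>2"
      by (intro divide_right_mono moment') simp
    also have "\<dots> = \<epsilon>"
      using assms(14) by (simp add: power2_eq_square power3_eq_cube)
    finally show ?thesis .
  qed
  have "incseq ?A"
    by (auto simp: incseq_def intro: stopped_sum_stays)
  then have "(\<lambda>k. prob (?A k)) \<longlonglongrightarrow> prob (\<Union>k. ?A k)"
    using A_sets by (intro finite_Lim_measure_incseq) auto
  then have prob_ever: "prob (\<Union>k. ?A k) \<le> \<epsilon>"
    by (rule LIMSEQ_le_const2) (use A_prob in auto)
  have "{\<omega> \<in> space P. \<exists>l. even l \<and>
      (\<Sum>i | i \<le> l \<and> even i. v (Z (i + 1) \<omega>) - v (Z i \<omega>)) \<ge> \<epsilon>} \<subseteq> (\<Union>k. ?A k)"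
  proof safe
    fix \<omega> l
    assume "\<omega> \<in> space P" and
      "(\<Sum>i | i \<le> l \<and> even i. v (Z (i + 1) \<omega>) - v (Z i \<omega>)) \<ge> \<epsilon>"
    then have "?T (Suc l) \<omega> \<ge> \<epsilon>"
      by (intro stopped_sum_reaches) (simp add: less_Suc_eq_le trajectory_def)
    then show "\<omega> \<in> (\<Union>k. ?A k)"
      using \<open>\<omega> \<in> space P\<close> by blast
  qed
  then have "\<P>(\<omega> in P. \<exists>l. even l \<and>
      (\<Sum>i | i \<le> l \<and> even i. v (Z (i + 1) \<omega>) - v (Z i \<omega>)) \<ge> \<epsilon>) \<le> prob (\<Union>k. ?A k)"
    using A_sets by (intro finite_measure_mono) auto
  then show ?thesis
    using prob_ever by linarith
qed

end
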